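(* Let $R$ be a commutative ring and $B,C,D\in R$. Then the standard elliptic divisibility sequence $h=\operatorname{EDS}(B,C,D)=(h_n)_{n\in\mathbb{Z}}$ satisfies the elliptic relation $$h_{a+b}h_{a-b}h_{c+d}h_{c-d}=h_{a+c}h_{a-c}h_{b+d}h_{b-d}-h_{b+c}h_{b-c}h_{a+d}h_{a-d}$$ for all $a,b,c,d\in\mathbb{Z}$, and is a divisibility sequence: $h_m\mid h_{nm}$ in $R$ for all $m,n\in\mathbb{Z}$.
   Context: Given $B,C,D$ in a commutative ring $R$, define $(\tilde h_n)_{n\in\mathbb{Z}}$ by $\tilde h_0=0$, $\tilde h_1=\tilde h_2=1$, $\tilde h_3=C$, $\tilde h_4=D$, and $\tilde h_{2n+1}=B^4\tilde h_{n+2}\tilde h_n^3-\tilde h_{n-1}\tilde h_{n+1}^3$ for even $n\ge2$; $\tilde h_{2n+1}=\tilde h_{n+2}\tilde h_n^3-B^4\tilde h_{n-1}\tilde h_{n+1}^3$ for odd $n\ge3$; $\tilde h_{2n}=\tilde h_n(\tilde h_{n+2}\tilde h_{n-1}^2-\tilde h_{n+1}^2\tilde h_{n-2})$ for $n\ge3$; $\tilde h_n=-\tilde h_{-n}$ for $n<0$. The standard EDS $\operatorname{EDS}(B,C,D)$ is the sequence $(h_n)_{n\in\mathbb{Z}}$ with $h_n=\tilde h_n$ for $n$ odd and $h_n=B\tilde h_n$ for $n$ even (so $h_1=1,h_2=B,h_3=C,h_4=BD$). *)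

theory Defs
  imports Main
begin

text \<open>
  A commutative ring with unit is rendered by the sort \<open>{comm_ring, comm_monoid_mult}\<close>. Every
  type of class \<open>comm_ring_1\<close> has this sort; unlike \<open>comm_ring_1\<close>, the sort does not impose
  \<open>0 \<noteq> 1\<close>, so the zero ring is included.
\<close>

function eds_tilde ::
  "'a::{comm_ring, comm_monoid_mult} \<Rightarrow> 'a \<Rightarrow> 'a \<Rightarrow> int \<Rightarrow> 'a" where
  "eds_tilde B C D m =
    (if m < 0 then - eds_tilde B C D (- m)
     else if m = 0 then 0
     else if m = 1 \<or> m = 2 then 1
     else if m = 3 then C
     else if m = 4 then D
     else let n = m div 2 in
       if odd m then
         if even n then
           B ^ 4 * eds_tilde B C D (n + 2) * eds_tilde B C D n ^ 3
             - eds_tilde B C D (n - 1) * eds_tilde B C D (n + 1) ^ 3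
         else
           eds_tilde B C D (n + 2) * eds_tilde B C D n ^ 3
             - B ^ 4 * eds_tilde B C D (n - 1) * eds_tilde B C D (n + 1) ^ 3
       else
         eds_tilde B C D n *
           (eds_tilde B C D (n + 2) * eds_tilde B C D (n - 1) ^ 2
             - eds_tilde B C D (n + 1) ^ 2 * eds_tilde B C D (n - 2)))"
  by pat_completeness auto
termination
proof (relation "measure (\<lambda>(B, C, D, m). nat (2 * \<bar>m\<bar> + (if m < 0 then 1 else 0)))",
    goal_cases)
  case 1
  show ?case by simp
qed (simp_all, (presburger+)?)

declare eds_tilde.simps [simp del]

definition EDS ::
  "'a::{comm_ring, comm_monoid_mult} \<Rightarrow> 'a \<Rightarrow> 'a \<Rightarrow> int \<Rightarrow> 'a" where
  "EDS B C D n = (if odd n then eds_tilde B C D n else B * eds_tilde B C D n)"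

lemma eds_tilde_base:
  "eds_tilde B C D 0 = 0" "eds_tilde B C D 1 = 1" "eds_tilde B C D 2 = 1"
  "eds_tilde B C D 3 = C" "eds_tilde B C D 4 = D"
  by (subst eds_tilde.simps, simp)+

lemma eds_tilde_neg: "n < 0 \<Longrightarrow> eds_tilde B C D n = - eds_tilde B C D (- n)"
  by (subst eds_tilde.simps) simp

lemma eds_tilde_odd_even:
  assumes "even n" "n \<ge> 2"
  shows "eds_tilde B C D (2 * n + 1) =
    B ^ 4 * eds_tilde B C D (n + 2) * eds_tilde B C D n ^ 3
      - eds_tilde B C D (n - 1) * eds_tilde B C D (n + 1) ^ 3"
  using assms by (subst eds_tilde.simps) (simp add: Let_def)

lemma eds_tilde_odd_odd:
  assumes "odd n" "n \<ge> 3"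
  shows "eds_tilde B C D (2 * n + 1) =
    eds_tilde B C D (n + 2) * eds_tilde B C D n ^ 3
      - B ^ 4 * eds_tilde B C D (n - 1) * eds_tilde B C D (n + 1) ^ 3"
  using assms by (subst eds_tilde.simps) (simp add: Let_def)

lemma eds_tilde_double:
  assumes "n \<ge> 3"
  shows "eds_tilde B C D (2 * n) =
    eds_tilde B C D n *
      (eds_tilde B C D (n + 2) * eds_tilde B C D (n - 1) ^ 2
        - eds_tilde B C D (n + 1) ^ 2 * eds_tilde B C D (n - 2))"
  using assms by (subst eds_tilde.simps) (auto simp: Let_def)

lemma EDS_base:
  "EDS B C D 1 = 1" "EDS B C D 2 = B" "EDS B C D 3 = C" "EDS B C D 4 = B * D"
  by (simp_all add: EDS_def eds_tilde_base)

end

theory Submission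
  imports Defs "HOL-Computational_Algebra.Polynomial"
begin

text \<open>
  Put \<open>f a b = h (a + b) * h (a - b)\<close>. If \<open>f a b = v a * u b - v b * u a\<close> with
  \<open>v a = h (a + 1) * h (a - 1)\<close> and \<open>u a = h a ^ 2\<close>, then the elliptic relation is the
  three-term Pluecker relation. This formula for \<open>f\<close>, and its analogue for half-integer
  \<open>a, b\<close>, are proved by a simultaneous induction on the larger index: the defining recurrences
  are the case \<open>b = a - 1\<close>, and all other cases are Pluecker relations with smaller indices.
  The half-integer case and the divisibility \<open>h m dvd h (n * m)\<close> need the cancellation of \<open>B\<close>
  and of \<open>h m\<close>. This is possible over \<open>\<int>[B, C, D]\<close>, where \<open>h m \<noteq> 0\<close> because the
  specialization \<open>(2, 3, 2)\<close> gives \<open>h m = m\<close>. The general case follows by specialization.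
\<close>

text \<open>The identity between the six 2x2 minors of four vectors \<open>(v i, u i)\<close>. The
  hypothesis concerns only the four indices involved, so that it is available inside an
  induction.\<close>

lemma pluecker:
  fixes u v :: "'i \<Rightarrow> 'a::comm_ring"
  assumes "\<And>i j. i \<in> {p, q, r, s} \<Longrightarrow> j \<in> {p, q, r, s} \<Longrightarrow> f i j = v i * u j - v j * u i"
  shows "f p q * f r s = f p r * f q s - f p s * f q r"
proof -
  have "f p q = v p * u q - v q * u p" "f r s = v r * u s - v s * u r"
    "f p r = v p * u r - v r * u p" "f q s = v q * u s - v s * u q"
    "f p s = v p * u s - v s * u p" "f q r = v q * u r - v r * u q"
    by (intro assms; simp)+
  then show ?thesis by (simp only:) (simp add: algebra_simps)
qed

section \<open>From the recurrences to the elliptic relation over a domain\<close>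

locale elliptic_recurrence =
  fixes B :: "'a::idom" and h :: "int \<Rightarrow> 'a"
  assumes B_nz: "B \<noteq> 0"
    and h_neg: "h (- n) = - h n"
    and h_0: "h 0 = 0" and h_1: "h 1 = 1" and h_2: "h 2 = B"
    and odd_rec: "n \<ge> 0 \<Longrightarrow> h (2 * n + 1) = h (n + 2) * h n ^ 3 - h (n - 1) * h (n + 1) ^ 3"
    and even_rec: "n \<ge> 0 \<Longrightarrow>
      B * h (2 * n) = h n * (h (n + 2) * h (n - 1) ^ 2 - h (n + 1) ^ 2 * h (n - 2))"
begin

definition ell :: "int \<Rightarrow> int \<Rightarrow> bool" where
  "ell a b \<longleftrightarrow>
    h (a + b) * h (a - b) = h (a + 1) * h (a - 1) * h b ^ 2 - h (b + 1) * h (b - 1) * h a ^ 2"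

text \<open>The elliptic relation at the half-integers \<open>a - 1/2\<close>, \<open>b - 1/2\<close>, \<open>3/2\<close>, \<open>1/2\<close>.\<close>

definition half_ell :: "int \<Rightarrow> int \<Rightarrow> bool" where
  "half_ell a b \<longleftrightarrow>
    B * (h (a + b - 1) * h (a - b)) =
      h (a + 1) * h (a - 2) * (h b * h (b - 1)) - h (b + 1) * h (b - 2) * (h a * h (a - 1))"

lemma h_eq_minus: "m = - n \<Longrightarrow> h m = - h n"
  by (simp add: h_neg)

lemma h_swap: "h (a - b) = - h (b - a)"
  by (rule h_eq_minus) simp

lemma ell_refl: "ell a a"
  by (simp add: ell_def h_0)

lemma half_ell_refl: "half_ell a a"
  by (simp add: half_ell_def h_0)

lemma ell_sym: "ell a b \<Longrightarrow> ell b a"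
  using h_swap[of b a] by (simp add: ell_def algebra_simps)

lemma half_ell_sym: "half_ell a b \<Longrightarrow> half_ell b a"
  using h_swap[of b a] by (simp add: half_ell_def algebra_simps)

lemma ell_reflect:
  assumes "ell a b"
  shows "ell (- a) b"
proof -
  have "h (- a + b) = - h (a - b)" "h (- a - b) = - h (a + b)"
    "h (- a + 1) = - h (a - 1)" "h (- a - 1) = - h (a + 1)" "h (- a) = - h a"
    by (rule h_eq_minus; simp)+
  then show ?thesis
    using assms unfolding ell_def by (simp only:) (simp add: mult.commute)
qed

text \<open>The negative of the half-integer \<open>a - 1/2\<close> is \<open>(1 - a) - 1/2\<close>,
  so \<open>1 - a\<close> takes the place of \<open>- a\<close> in
  \<open>ell_reflect\<close>.\<close>

lemma half_ell_reflect:
  assumes "half_ell a b"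
  shows "half_ell (1 - a) b"
proof -
  have "h (1 - a + b - 1) = - h (a - b)" "h (1 - a - b) = - h (a + b - 1)"
    "h (1 - a + 1) = - h (a - 2)" "h (1 - a - 2) = - h (a + 1)"
    "h (1 - a) = - h (a - 1)" "h (1 - a - 1) = - h a"
    by (rule h_eq_minus; simp)+
  then show ?thesis
    using assms unfolding half_ell_def by (simp only:) (simp add: mult.commute)
qed

lemma ell_extend:
  assumes "\<And>p q. 0 \<le> q \<Longrightarrow> q < p \<Longrightarrow> p \<le> N \<Longrightarrow> ell p q" "\<bar>a\<bar> \<le> N" "\<bar>b\<bar> \<le> N"
  shows "ell a b"
proof -
  have "ell \<bar>a\<bar> \<bar>b\<bar>"
    using assms ell_refl ell_sym by (metis abs_ge_zero linorder_neqE)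
  then show ?thesis
    by (metis abs_if ell_reflect ell_sym minus_minus)
qed

text \<open>The bounds say that \<open>a - 1/2\<close> and \<open>b - 1/2\<close> have absolute
  value at most \<open>N - 1/2\<close>.\<close>

lemma half_ell_extend:
  assumes "\<And>p q. 1 \<le> q \<Longrightarrow> q < p \<Longrightarrow> p \<le> N \<Longrightarrow> half_ell p q"
    "1 - N \<le> a" "a \<le> N" "1 - N \<le> b" "b \<le> N"
  shows "half_ell a b"
proof -
  define p q where "p = (if a \<ge> 1 then a else 1 - a)" and "q = (if b \<ge> 1 then b else 1 - b)"
  have "1 \<le> p" "p \<le> N" "1 \<le> q" "q \<le> N"
    using assms(2-) by (auto simp: p_def q_def)
  then have "half_ell p q"
    using assms(1) half_ell_refl half_ell_sym by (metis linorder_neqE)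
  moreover have "a = p \<or> a = 1 - p" "b = q \<or> b = 1 - q"
    by (auto simp: p_def q_def)
  ultimately show ?thesis
    by (metis half_ell_reflect half_ell_sym)
qed

lemma ell_pluecker:
  assumes "\<And>i j. i \<in> {p, q, r, s} \<Longrightarrow> j \<in> {p, q, r, s} \<Longrightarrow> ell i j"
  shows "h (p + q) * h (p - q) * (h (r + s) * h (r - s)) =
    h (p + r) * h (p - r) * (h (q + s) * h (q - s))
      - h (p + s) * h (p - s) * (h (q + r) * h (q - r))"
  using assms
  by (intro pluecker[where f = "\<lambda>i j. h (i + j) * h (i - j)" and v = "\<lambda>i. h (i + 1) * h (i - 1)"
        and u = "\<lambda>i. h i ^ 2"]) (auto simp: ell_def)

lemma half_ell_pluecker:
  assumes "\<And>i j. i \<in> {p, q, r, s} \<Longrightarrow> j \<in> {p, q, r, s} \<Longrightarrow> half_ell i j"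
  shows "h (p + q - 1) * h (p - q) * (h (r + s - 1) * h (r - s)) =
    h (p + r - 1) * h (p - r) * (h (q + s - 1) * h (q - s))
      - h (p + s - 1) * h (p - s) * (h (q + r - 1) * h (q - r))"
proof -
  let ?f = "\<lambda>i j. h (i + j - 1) * h (i - j)"
  \<comment> \<open>\<open>half_ell\<close> expresses only \<open>B * ?f i j\<close> as a minor, so
    the relation first appears with a factor \<open>B * B\<close>, which cancels in a
    domain.\<close>
  have "(B * ?f p q) * (B * ?f r s) = (B * ?f p r) * (B * ?f q s) - (B * ?f p s) * (B * ?f q r)"
    using assms
    by (intro pluecker[where f = "\<lambda>i j. B * ?f i j" and v = "\<lambda>i. h (i + 1) * h (i - 2)"
          and u = "\<lambda>i. h i * h (i - 1)"]) (auto simp: half_ell_def)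
  then have "B * B * (?f p q * ?f r s) = B * B * (?f p r * ?f q s - ?f p s * ?f q r)"
    by (simp add: algebra_simps)
  then show ?thesis
    using B_nz by simp
qed

text \<open>
  The products in a four-index relation are unchanged when \<open>a, b, c, d\<close> are replaced by their
  differences with \<open>(a + b + c + d) / 2\<close>. In both steps this turns the relation to be proved
  into one whose indices are all smaller, unless \<open>b = a - 1\<close>.
\<close>

lemma ell_step:
  assumes ell: "\<And>p q. \<bar>p\<bar> < a \<Longrightarrow> \<bar>q\<bar> < a \<Longrightarrow> ell p q"
    and half: "\<And>p q. 1 - a \<le> p \<Longrightarrow> p \<le> a \<Longrightarrow> 1 - a \<le> q \<Longrightarrow> q \<le> a \<Longrightarrow> half_ell p q"
    and ba: "0 \<le> b" "b < a"
  shows "ell a b"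
proof -
  consider "b = a - 1" | "b < a - 1" "odd (a + b)" | "b < a - 1" "even (a + b)"
    using ba by linarith
  then show ?thesis
  proof cases
    case 1
    then have "a = b + 1" by simp
    then show ?thesis
      using odd_rec[OF ba(1)]
      by (simp add: ell_def h_1 algebra_simps power2_eq_square power3_eq_cube)
  next
    case 2
    then obtain k where k: "a + b = 2 * k + 1" by (elim oddE)
    \<comment> \<open>Up to order and signs, \<open>(a, b, 1, 0)\<close> becomes
      \<open>(x, x - 1, y, y - 1)\<close>; all four lie strictly between \<open>- a\<close> and
      \<open>a\<close> because \<open>b < a - 1\<close>.\<close>
    define x y where "x = k + 1" and "y = a - k"
    have ab: "a = x + y - 1" "b = x - y"
      using k by (auto simp: x_def y_def)
    have "h (x + (x - 1)) * h (x - (x - 1)) * (h (y + (y - 1)) * h (y - (y - 1))) =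
      h (x + y) * h (x - y) * (h ((x - 1) + (y - 1)) * h ((x - 1) - (y - 1)))
      - h (x + (y - 1)) * h (x - (y - 1)) * (h ((x - 1) + y) * h ((x - 1) - y))"
      using 2 ba ab by (intro ell_pluecker ell) auto
    then show ?thesis
      by (simp add: ell_def ab h_1 algebra_simps power2_eq_square)
  next
    case 3
    then obtain x where x: "a + b = 2 * x" by (elim evenE)
    \<comment> \<open>Half of \<open>a + b + 1\<close> is now \<open>x + 1/2\<close>, so the new
      indices are the half-integers \<open>x + 1/2\<close>, \<open>x - 1/2\<close>,
      \<open>y + 1/2\<close>, \<open>y - 1/2\<close>, encoded in \<open>half_ell\<close> as
      \<open>x + 1\<close>, \<open>x\<close>, \<open>y + 1\<close>, \<open>y\<close>.\<close>
    define y where "y = a - x"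
    have ab: "a = x + y" "b = x - y"
      using x by (auto simp: y_def)
    have "h ((x + 1) + x - 1) * h ((x + 1) - x) * (h ((y + 1) + y - 1) * h ((y + 1) - y)) =
      h ((x + 1) + (y + 1) - 1) * h ((x + 1) - (y + 1)) * (h (x + y - 1) * h (x - y))
      - h ((x + 1) + y - 1) * h ((x + 1) - y) * (h (x + (y + 1) - 1) * h (x - (y + 1)))"
      using 3 ba ab by (intro half_ell_pluecker half) auto
    then show ?thesis
      by (simp add: ell_def ab h_1 algebra_simps power2_eq_square)
  qed
qed

lemma half_ell_step:
  assumes ell: "\<And>p q. \<bar>p\<bar> < a \<Longrightarrow> \<bar>q\<bar> < a \<Longrightarrow> ell p q"
    and half: "\<And>p q. 1 - a < p \<Longrightarrow> p < a \<Longrightarrow> 1 - a < q \<Longrightarrow> q < a \<Longrightarrow> half_ell p q"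
    and ba: "1 \<le> b" "b < a"
  shows "half_ell a b"
proof -
  consider "b = a - 1" | "b = 1" | "b < a - 1" "b > 1" "odd (a + b)"
    | "b < a - 1" "b > 1" "even (a + b)"
    using ba by linarith
  then show ?thesis
  proof cases
    case 1
    then have "a = b + 1" by simp
    then show ?thesis
      using even_rec[of b] ba
      by (simp add: half_ell_def h_1 algebra_simps power2_eq_square)
  next
    case 2
    then show ?thesis
      using h_neg[of 1] by (simp add: half_ell_def h_0 h_1 h_2)
  next
    case 3
    then obtain k where k: "a + b = 2 * k + 1" by (elim oddE)
    \<comment> \<open>Up to order and signs, \<open>(a - 1/2, b - 1/2, 3/2, 1/2)\<close> becomes
      \<open>(x - 1/2, x - 3/2, y + 1/2, y - 3/2)\<close>.\<close>
    define x y where "x = k + 1" and "y = a - k"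
    have ab: "a = x + y - 1" "b = x - y"
      using k by (auto simp: x_def y_def)
    have "h (x + (x - 1) - 1) * h (x - (x - 1)) * (h ((y + 1) + (y - 1) - 1) * h ((y + 1) - (y - 1))) =
      h (x + (y + 1) - 1) * h (x - (y + 1)) * (h ((x - 1) + (y - 1) - 1) * h ((x - 1) - (y - 1)))
      - h (x + (y - 1) - 1) * h (x - (y - 1)) * (h ((x - 1) + (y + 1) - 1) * h ((x - 1) - (y + 1)))"
      using 3 ba ab by (intro half_ell_pluecker half) auto
    then show ?thesis
      by (simp add: half_ell_def ab h_1 h_2 algebra_simps)
  next
    case 4
    then obtain x where x: "a + b = 2 * x" by (elim evenE)
    \<comment> \<open>The same quadruple now becomes the integers
      \<open>x, x - 1, y + 1, y - 1\<close>, so \<open>ell\<close> applies.\<close>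
    define y where "y = a - x"
    have ab: "a = x + y" "b = x - y"
      using x by (auto simp: y_def)
    have "h (x + (x - 1)) * h (x - (x - 1)) * (h ((y + 1) + (y - 1)) * h ((y + 1) - (y - 1))) =
      h (x + (y + 1)) * h (x - (y + 1)) * (h ((x - 1) + (y - 1)) * h ((x - 1) - (y - 1)))
      - h (x + (y - 1)) * h (x - (y - 1)) * (h ((x - 1) + (y + 1)) * h ((x - 1) - (y + 1)))"
      using 4 ba ab by (intro ell_pluecker ell) auto
    then show ?thesis
      by (simp add: half_ell_def ab h_1 h_2 algebra_simps)
  qed
qed

text \<open>The induction alternates between integers and half-integers: index \<open>N + 1\<close>
  of \<open>half_ell\<close> stands for \<open>N + 1/2\<close>. Hence \<open>ell\<close> at
  \<open>N + 1\<close> may use the whole hypothesis, and \<open>half_ell\<close> at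
  \<open>N + 2\<close> also uses the new \<open>ell\<close>.\<close>

lemma ell_half_ell_bounded:
  "(\<forall>a b. \<bar>a\<bar> \<le> int N \<longrightarrow> \<bar>b\<bar> \<le> int N \<longrightarrow> ell a b) \<and>
   (\<forall>a b. - int N \<le> a \<longrightarrow> a \<le> int N + 1 \<longrightarrow> - int N \<le> b \<longrightarrow> b \<le> int N + 1 \<longrightarrow> half_ell a b)"
proof (induction N)
  case 0
  have "half_ell a b" if "- int 0 \<le> a" "a \<le> int 0 + 1" "- int 0 \<le> b" "b \<le> int 0 + 1" for a b
    by (rule half_ell_extend[of 1]) (use that in auto)
  then show ?case
    using ell_refl by auto
next
  case (Suc N)
  have ell: "ell a b" if "\<bar>a\<bar> \<le> int (Suc N)" "\<bar>b\<bar> \<le> int (Suc N)" for a b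
  proof (rule ell_extend[OF _ that])
    fix p q :: int assume pq: "0 \<le> q" "q < p" "p \<le> int (Suc N)"
    show "ell p q"
      by (rule ell_step) (use pq Suc.IH in auto)
  qed
  have "half_ell a b" if "- int (Suc N) \<le> a" "a \<le> int (Suc N) + 1"
    "- int (Suc N) \<le> b" "b \<le> int (Suc N) + 1" for a b
  proof (rule half_ell_extend[of "int (Suc N) + 1"])
    fix p q :: int assume pq: "1 \<le> q" "q < p" "p \<le> int (Suc N) + 1"
    show "half_ell p q"
      by (rule half_ell_step) (use pq Suc.IH ell in auto)
  qed (use that in auto)
  with ell show ?case by blast
qed

lemma ell_all: "ell a b"
proof -
  have "\<bar>a\<bar> \<le> int (nat (\<bar>a\<bar> + \<bar>b\<bar>))" "\<bar>b\<bar> \<le> int (nat (\<bar>a\<bar> + \<bar>b\<bar>))"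
    by simp_all
  then show ?thesis
    using ell_half_ell_bounded by blast
qed

lemma elliptic_relation:
  "h (a + b) * h (a - b) * h (c + d) * h (c - d) =
   h (a + c) * h (a - c) * h (b + d) * h (b - d) - h (b + c) * h (b - c) * h (a + d) * h (a - d)"
  using ell_pluecker[of a b c d] ell_all by (simp add: algebra_simps)

text \<open>For odd multiples, apply \<open>ell\<close> to \<open>(j + 1) * m\<close> and
  \<open>j * m\<close>: their difference is \<open>m\<close>, the right side is divisible by
  \<open>h m ^ 2\<close>, and one \<open>h m\<close> cancels. Doubling is a hypothesis because
  \<open>even_rec\<close> only yields \<open>h x dvd B * h (2 * x)\<close>.\<close>

lemma dvd_multiple:
  assumes nz: "h m \<noteq> 0" and double: "\<And>x. x \<ge> 0 \<Longrightarrow> h x dvd h (2 * x)" and m: "m > 0"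
  shows "h m dvd h (int n * m)"
proof (induction n rule: less_induct)
  case (less n)
  consider "n = 0" | "n = 1" | j where "n = 2 * j" "j > 0" | j where "n = 2 * j + 1" "j > 0"
    by (cases "even n") (force elim!: evenE oddE)+
  then show ?case
  proof cases
    case 1 then show ?thesis by (simp add: h_0)
  next
    case 2 then show ?thesis by simp
  next
    case 3
    then have "h m dvd h (int j * m)" using less.IH by simp
    also have "\<dots> dvd h (2 * (int j * m))" using m by (intro double) simp
    finally show ?thesis using 3 by (simp add: algebra_simps)
  next
    case 4
    then have "h m dvd h (int j * m)" "h m dvd h (int (j + 1) * m)"
      by (intro less.IH; simp)+
    then obtain q r where q: "h (int j * m) = h m * q" and r: "h (int (j + 1) * m) = h m * r"
      by (elim dvdE)
    let ?a = "int (j + 1) * m" and ?b = "int j * m"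
    have idx: "?a + ?b = int n * m" "?a - ?b = m"
      using 4 by (simp_all add: algebra_simps)
    have "h (int n * m) * h m = h (?a + 1) * h (?a - 1) * h ?b ^ 2 - h (?b + 1) * h (?b - 1) * h ?a ^ 2"
      using ell_all[of ?a ?b] unfolding ell_def idx .
    also have "\<dots> = h m * (h (?a + 1) * h (?a - 1) * q ^ 2 - h (?b + 1) * h (?b - 1) * r ^ 2) * h m"
      unfolding q r by (simp add: algebra_simps power2_eq_square)
    finally show ?thesis using nz by simp
  qed
qed

end

section \<open>The recurrences of \<open>EDS\<close>, uniform in parity\<close>

lemma eds_tilde_uminus: "eds_tilde B C D (- n) = - eds_tilde B C D n"
  using eds_tilde_neg[of n B C D] eds_tilde_neg[of "- n" B C D] eds_tilde_base(1)[of B C D]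
  by (cases n "0 :: int" rule: linorder_cases) auto

lemma EDS_uminus: "EDS B C D (- n) = - EDS B C D n"
  by (simp add: EDS_def eds_tilde_uminus)

lemma EDS_0: "EDS B C D 0 = 0"
  by (simp add: EDS_def eds_tilde_base)

lemma eds_tilde_double':
  assumes "n \<ge> 0"
  shows "eds_tilde B C D (2 * n) =
    eds_tilde B C D n *
      (eds_tilde B C D (n + 2) * eds_tilde B C D (n - 1) ^ 2
        - eds_tilde B C D (n + 1) ^ 2 * eds_tilde B C D (n - 2))"
proof -
  consider "n = 0" | "n = 1" | "n = 2" | "n \<ge> 3"
    using assms by linarith
  then show ?thesis
    by cases (use eds_tilde_double in \<open>simp_all add: eds_tilde_base eds_tilde_neg power2_eq_square\<close>)
qed

text \<open>In the product whose four factors all have even index, the four factors \<open>B\<close>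
  of \<open>EDS\<close> account for the \<open>B ^ 4\<close>; this merges the two parity
  cases.\<close>

lemma EDS_odd:
  assumes "n \<ge> 0"
  shows "EDS B C D (2 * n + 1) =
    EDS B C D (n + 2) * EDS B C D n ^ 3 - EDS B C D (n - 1) * EDS B C D (n + 1) ^ 3"
proof -
  consider "n = 0" | "n = 1" | "n \<ge> 2" "even n" | "n \<ge> 3" "odd n"
    using assms by (cases "n = 2") force+
  then show ?thesis
  proof cases
    case 3
    then show ?thesis
      unfolding EDS_def eds_tilde_odd_even[OF 3(2,1)]
      by (simp add: power_mult_distrib eval_nat_numeral mult_ac)
  next
    case 4
    then show ?thesis
      unfolding EDS_def eds_tilde_odd_odd[OF 4(2,1)]
      by (simp add: power_mult_distrib eval_nat_numeral mult_ac)
  qed (simp_all add: EDS_def eds_tilde_base eds_tilde_neg power3_eq_cube)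
qed

text \<open>Each product on the right has two factors of even index, counted with multiplicity,
  whereas \<open>EDS B C D (2 * n)\<close> carries one \<open>B\<close>; hence the extra
  \<open>B\<close> on the left.\<close>

lemma EDS_double:
  assumes "n \<ge> 0"
  shows "B * EDS B C D (2 * n) =
    EDS B C D n * (EDS B C D (n + 2) * EDS B C D (n - 1) ^ 2
      - EDS B C D (n + 1) ^ 2 * EDS B C D (n - 2))"
  unfolding EDS_def eds_tilde_double'[OF assms] by (simp add: algebra_simps power2_eq_square)

text \<open>Read off from \<open>eds_tilde\<close>, whose doubling formula has no factor
  \<open>B\<close>, so that nothing has to be cancelled.\<close>

lemma EDS_dvd_double:
  assumes "n \<ge> 0"
  shows "EDS B C D n dvd EDS B C D (2 * n)"
  by (auto simp: EDS_def eds_tilde_double'[OF assms] mult_dvd_mono)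

lemma elliptic_recurrence_EDS:
  "(B :: 'a::idom) \<noteq> 0 \<Longrightarrow> elliptic_recurrence B (EDS B C D)"
  by unfold_locales (auto simp: EDS_uminus EDS_0 EDS_base EDS_odd EDS_double)

section \<open>Ring homomorphisms: naturality of \<open>EDS\<close>, maps out of
  \<open>\<int>\<close> and polynomial rings\<close>

locale unital_hom =
  fixes \<phi> :: "'a::{comm_ring, comm_monoid_mult} \<Rightarrow> 'b::{comm_ring, comm_monoid_mult}"
  assumes hom_one: "\<phi> 1 = 1"
    and hom_add: "\<phi> (x + y) = \<phi> x + \<phi> y"
    and hom_mult: "\<phi> (x * y) = \<phi> x * \<phi> y"
begin

lemma hom_zero: "\<phi> 0 = 0"
  using hom_add[of 0 0] by simp

lemma hom_uminus: "\<phi> (- x) = - \<phi> x"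
  using hom_add[of x "- x"] by (simp add: hom_zero eq_neg_iff_add_eq_0 add.commute)

lemma hom_diff: "\<phi> (x - y) = \<phi> x - \<phi> y"
  using hom_add[of x "- y"] by (simp add: hom_uminus)

lemma hom_power: "\<phi> (x ^ n) = \<phi> x ^ n"
  by (induction n) (simp_all add: hom_one hom_mult)

lemma hom_dvd: "x dvd y \<Longrightarrow> \<phi> x dvd \<phi> y"
  by (auto simp: dvd_def hom_mult)

text \<open>Each term is an integer polynomial in \<open>B\<close>, \<open>C\<close>,
  \<open>D\<close>.\<close>

lemma hom_eds_tilde: "\<phi> (eds_tilde B C D m) = eds_tilde (\<phi> B) (\<phi> C) (\<phi> D) m"
proof -
  have nat: "\<phi> (eds_tilde B C D (int n)) = eds_tilde (\<phi> B) (\<phi> C) (\<phi> D) (int n)" for n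
  proof (induction n rule: less_induct)
    case (less n)
    have IH: "\<phi> (eds_tilde B C D m) = eds_tilde (\<phi> B) (\<phi> C) (\<phi> D) m"
      if "0 \<le> m" "m < int n" for m
      using less.IH[of "nat m"] that by simp
    consider "n = 0" | "n = 1" | "n = 2" | "n = 3" | "n = 4"
      | k where "int n = 2 * k + 1" "even k" "k \<ge> 2" | k where "int n = 2 * k + 1" "odd k" "k \<ge> 3"
      | k where "int n = 2 * k" "k \<ge> 3"
    proof -
      obtain k where "int n = 2 * k \<or> int n = 2 * k + 1"
        by (metis evenE oddE)
      then show ?thesis
        using that by (cases "even k"; cases "k = 2") force+
    qed
    then show ?case
    proof cases
      case (6 k)
      show ?thesis
        unfolding 6(1) eds_tilde_odd_even[OF 6(2,3)]
        using 6 by (simp add: IH hom_mult hom_diff hom_power)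
    next
      case (7 k)
      show ?thesis
        unfolding 7(1) eds_tilde_odd_odd[OF 7(2,3)]
        using 7 by (simp add: IH hom_mult hom_diff hom_power)
    next
      case (8 k)
      show ?thesis
        unfolding 8(1) eds_tilde_double[OF 8(2)]
        using 8 by (simp add: IH hom_mult hom_diff hom_power)
    qed (simp_all add: eds_tilde_base hom_zero hom_one)
  qed
  show ?thesis
  proof (cases "m \<ge> 0")
    case True
    then show ?thesis using nat[of "nat m"] by simp
  next
    case False
    then show ?thesis using nat[of "nat (- m)"] by (simp add: eds_tilde_uminus hom_uminus)
  qed
qed

lemma hom_EDS: "\<phi> (EDS B C D n) = EDS (\<phi> B) (\<phi> C) (\<phi> D) n"
  by (simp add: EDS_def hom_eds_tilde hom_mult)

end

text \<open>The class of \<open>of_int\<close> forces \<open>0 \<noteq> 1\<close>, so the map is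
  built by hand: \<open>g n\<close> is the \<open>n\<close>-fold sum of \<open>1\<close>, extended
  to differences of naturals.\<close>

lemma int_hom_exists: "\<exists>\<phi> :: int \<Rightarrow> 'a::{comm_ring, comm_monoid_mult}. unital_hom \<phi>"
proof -
  define g :: "nat \<Rightarrow> 'a" where "g n = ((+) 1 ^^ n) 0" for n
  have g_0: "g 0 = 0" and g_Suc: "g (Suc n) = 1 + g n" for n
    by (simp_all add: g_def)
  have g_add: "g (m + n) = g m + g n" for m n
    by (induction m) (simp_all add: g_0 g_Suc algebra_simps)
  have g_mult: "g (m * n) = g m * g n" for m n
    by (induction m) (simp_all add: g_0 g_Suc g_add distrib_right)
  define \<phi> where "\<phi> k = g (nat k) - g (nat (- k))" for k
  have \<phi>: "\<phi> (int m - int n) = g m - g n" for m n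
  proof -
    have "nat (int m - int n) + n = m + nat (- (int m - int n))"
      by linarith
    then have "g (nat (int m - int n)) + g n = g m + g (nat (- (int m - int n)))"
      by (metis g_add)
    then show ?thesis
      unfolding \<phi>_def by (simp only: diff_eq_eq diff_add_eq eq_diff_eq)
  qed
  have "unital_hom \<phi>"
  proof
    show "\<phi> 1 = 1"
      using \<phi>[of "Suc 0" 0] by (simp add: g_0 g_Suc)
  next
    fix x y :: int
    obtain a b where x: "x = int a - int b" by (rule int_diff_cases)
    obtain c d where y: "y = int c - int d" by (rule int_diff_cases)
    have "\<phi> (x + y) = \<phi> (int (a + c) - int (b + d))"
      by (simp add: x y algebra_simps)
    then show "\<phi> (x + y) = \<phi> x + \<phi> y"
      unfolding \<phi> by (simp add: x y \<phi> g_add algebra_simps)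
    have "\<phi> (x * y) = \<phi> (int (a * c + b * d) - int (a * d + b * c))"
      by (simp add: x y algebra_simps)
    then show "\<phi> (x * y) = \<phi> x * \<phi> y"
      unfolding \<phi> by (simp add: x y \<phi> g_add g_mult algebra_simps)
  qed
  then show ?thesis by blast
qed

context
  fixes \<phi> :: "'a::comm_ring_1 \<Rightarrow> 'b::{comm_ring, comm_monoid_mult}"
  assumes hom: "unital_hom \<phi>"
begin

interpretation unital_hom \<phi> by (rule hom)

lemma poly_map_poly_pCons: "poly (map_poly \<phi> (pCons a p)) x = \<phi> a + x * poly (map_poly \<phi> p) x"
  by (simp add: map_poly_pCons hom_zero)

lemma unital_hom_poly: "unital_hom (\<lambda>p. poly (map_poly \<phi> p) x)"
proof
  let ?F = "\<lambda>p. poly (map_poly \<phi> p) x"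
  show "?F 1 = 1"
    by (simp add: one_pCons poly_map_poly_pCons hom_one)
  have add: "?F (p + q) = ?F p + ?F q" for p q
    by (induction p q rule: poly_induct2) (simp_all add: poly_map_poly_pCons hom_add algebra_simps)
  have smult: "?F (smult a q) = \<phi> a * ?F q" for a q
    by (induction q) (simp_all add: poly_map_poly_pCons hom_mult algebra_simps)
  show "?F (p + q) = ?F p + ?F q" for p q
    by (rule add)
  show "?F (p * q) = ?F p * ?F q" for p q
    by (induction p) (simp_all add: poly_map_poly_pCons add smult hom_zero algebra_simps)
qed

text \<open>The universal property of the polynomial ring, realized by evaluation at
  \<open>x\<close>.\<close>

lemma unital_hom_poly_exists:
  "\<exists>\<psi> :: 'a poly \<Rightarrow> 'b. unital_hom \<psi> \<and> \<psi> [:0, 1:] = x \<and> (\<forall>a. \<psi> [:a:] = \<phi> a)"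
  using unital_hom_poly[of x]
  by (intro exI[of _ "\<lambda>p. poly (map_poly \<phi> p) x"])
    (simp add: poly_map_poly_pCons hom_one hom_zero)

end

section \<open>The generic sequence over \<open>\<int>[B][C][D]\<close>\<close>

abbreviation generic_B :: "int poly poly poly" where "generic_B \<equiv> [:[:[:0, 1:]:]:]"
abbreviation generic_C :: "int poly poly poly" where "generic_C \<equiv> [:[:0, 1:]:]"
abbreviation generic_D :: "int poly poly poly" where "generic_D \<equiv> [:0, 1:]"

text \<open>The universal property is applied three times, from the innermost polynomial ring
  outwards, prescribing the images of the three variables.\<close>

lemma generic_specialization:
  fixes B C D :: "'a::{comm_ring, comm_monoid_mult}"
  obtains \<phi> :: "int poly poly poly \<Rightarrow> 'a"
  where "unital_hom \<phi>" "\<And>n. \<phi> (EDS generic_B generic_C generic_D n) = EDS B C D n"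
proof -
  obtain \<phi>0 :: "int \<Rightarrow> 'a" where 0: "unital_hom \<phi>0"
    using int_hom_exists by blast
  obtain \<phi>1 :: "int poly \<Rightarrow> 'a" where 1: "unital_hom \<phi>1" "\<phi>1 [:0, 1:] = B"
    using unital_hom_poly_exists[OF 0, of B] by blast
  obtain \<phi>2 :: "int poly poly \<Rightarrow> 'a" where 2: "unital_hom \<phi>2" "\<phi>2 [:0, 1:] = C" "\<And>a. \<phi>2 [:a:] = \<phi>1 a"
    using unital_hom_poly_exists[OF 1(1), of C] by blast
  obtain \<phi>3 :: "int poly poly poly \<Rightarrow> 'a" where 3: "unital_hom \<phi>3" "\<phi>3 [:0, 1:] = D" "\<And>a. \<phi>3 [:a:] = \<phi>2 a"
    using unital_hom_poly_exists[OF 2(1), of D] by blast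
  show ?thesis
    by (rule that[OF 3(1)]) (simp add: unital_hom.hom_EDS[OF 3(1)] 1 2 3)
qed

text \<open>The parameters are dictated by \<open>h n = n\<close>: \<open>B = 2\<close>,
  \<open>C = 3\<close> and \<open>B * D = 4\<close>. The identity sequence satisfies both
  recurrences.\<close>

lemma EDS_2_3_2: "EDS 2 3 2 (int n) = int n"
proof (induction n rule: less_induct)
  case (less n)
  have IH: "EDS 2 3 2 m = m" if "0 \<le> m" "m < int n" for m :: int
    using less.IH[of "nat m"] that by simp
  consider "n = 0" | "n = 1" | "n = 2" | "n = 3" | "n = 4" | k where "n = 2 * k + 1" "k \<ge> 2"
    | k where "n = 2 * k" "k \<ge> 3"
    by (cases "even n") (force elim!: evenE oddE)+
  then show ?case
  proof cases
    case 6
    then have "EDS 2 3 2 (int n) = (int k + 2) * int k ^ 3 - (int k - 1) * (int k + 1) ^ 3"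
      using EDS_odd[of "int k" 2 3 "2 :: int"] by (simp add: IH add.commute)
    then show ?thesis
      using 6 by (simp add: algebra_simps power3_eq_cube)
  next
    case 7
    then have "2 * EDS 2 3 2 (int n) =
        int k * ((int k + 2) * (int k - 1) ^ 2 - (int k + 1) ^ 2 * (int k - 2))"
      using EDS_double[of "int k" 2 3 "2 :: int"] by (simp add: IH)
    also have "\<dots> = 2 * int n"
      using 7 by (simp add: algebra_simps power2_eq_square)
    finally show ?thesis by simp
  qed (simp_all add: EDS_0 EDS_base)
qed

lemma generic_EDS_nonzero:
  assumes "n > 0"
  shows "EDS generic_B generic_C generic_D n \<noteq> 0"
proof
  assume zero: "EDS generic_B generic_C generic_D n = 0"
  obtain \<phi> where \<phi>: "unital_hom \<phi>"
    "\<And>n. \<phi> (EDS generic_B generic_C generic_D n) = EDS 2 3 (2 :: int) n"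
    using generic_specialization[of 2 3 "2 :: int"] by metis
  have "EDS 2 3 2 n = (0 :: int)"
    using \<phi>(2)[of n] zero unital_hom.hom_zero[OF \<phi>(1)] by simp
  then show False
    using EDS_2_3_2[of "nat n"] assms by simp
qed

interpretation generic: elliptic_recurrence generic_B "EDS generic_B generic_C generic_D"
  by (rule elliptic_recurrence_EDS) simp

lemma generic_EDS_dvd:
  "EDS generic_B generic_C generic_D m dvd EDS generic_B generic_C generic_D (n * m)"
proof -
  let ?h = "EDS generic_B generic_C generic_D"
  have pos: "?h k dvd ?h (int j * k)" if "k \<ge> 0" for j k
  \<comment> \<open>At \<open>k = 0\<close> the term \<open>?h k\<close> vanishes and cannot be
    cancelled, but then both sides are \<open>?h 0\<close>.\<close>
  proof (cases "k = 0")
    case False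
    then show ?thesis
      using that by (intro generic.dvd_multiple generic_EDS_nonzero EDS_dvd_double) auto
  qed simp
  \<comment> \<open>Signs do not affect divisibility, which reduces the claim to
    \<open>pos\<close>.\<close>
  have abs: "?h k dvd x \<longleftrightarrow> ?h \<bar>k\<bar> dvd x" "x dvd ?h k \<longleftrightarrow> x dvd ?h \<bar>k\<bar>" for k x
    by (simp_all add: abs_if EDS_uminus)
  have "?h \<bar>m\<bar> dvd ?h (int (nat \<bar>n\<bar>) * \<bar>m\<bar>)"
    by (rule pos) simp
  then show ?thesis
    by (subst abs(1), subst abs(2)) (simp add: abs_mult)
qed

theorem theorem4p2:
  fixes B C D :: "'a::{comm_ring, comm_monoid_mult}"
  defines "h \<equiv> EDS B C D"
  shows "(\<forall>a b c d :: int.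
            h (a + b) * h (a - b) * h (c + d) * h (c - d) =
            h (a + c) * h (a - c) * h (b + d) * h (b - d)
              - h (b + c) * h (b - c) * h (a + d) * h (a - d))
       \<and> (\<forall>m n :: int. h m dvd h (n * m))"
proof -
  obtain \<phi> where \<phi>: "unital_hom \<phi>" and h: "\<And>n. \<phi> (EDS generic_B generic_C generic_D n) = h n"
    unfolding h_def using generic_specialization[of B C D] by metis
  interpret unital_hom \<phi> by (rule \<phi>)
  have "h (a + b) * h (a - b) * h (c + d) * h (c - d) =
      h (a + c) * h (a - c) * h (b + d) * h (b - d)
        - h (b + c) * h (b - c) * h (a + d) * h (a - d)" for a b c d
    using arg_cong[OF generic.elliptic_relation[of a b c d], of \<phi>]
    by (simp only: hom_mult hom_diff h)
  moreover have "h m dvd h (n * m)" for m n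
    using hom_dvd[OF generic_EDS_dvd[of m n]] by (simp only: h)
  ultimately show ?thesis by blast
qed

end
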